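(* Let $H$ be an upper entropy function. Let $n,m\ge1$ be integers, let $(p_1,\dots,p_n)\in\Omega_n$, and for each $i\in\{1,\dots,n\}$ let $(p_{i1},\dots,p_{im})\in\Omega_m$ (the conditional probabilities $p_{ij}=P(Y=y_j\mid X=x_i)$, where $X$ has distribution $(p_1,\dots,p_n)$). Then $$H(p_1p_{11},\dots,p_1p_{1m},\,p_2p_{21},\dots,p_2p_{2m},\,\dots,\,p_np_{n1},\dots,p_np_{nm})\le H(p_1,\dots,p_n)+\sum_{i=1}^n p_iH(p_{i1},\dots,p_{im}).$$
   Context: For each integer $N\ge 1$ let $\Omega_N=\{(p_1,\dots,p_N): p_i\ge 0,\ \sum_{i=1}^N p_i=1\}$, and let $\Omega=\bigcup_{N\ge1}\Omega_N$. A function $H:\Omega\to\mathbb{R}$ is called an upper entropy function if it satisfies: (i) Continuity: the restriction of $H$ to each $\Omega_N$ is continuous, and $H(p_1,\dots,p_N)=0$ if and only if there is $k$ with $p_k=1$. (ii) Symmetry: $H(p_1,\dots,p_N)$ is invariant under permutations of its arguments. (iii) Increasing property: if $(p_1,\dots,p_N)\in\Omega_N$, $1\le n\le N$, $m\ge1$, $q_1,\dots,q_m\ge 0$ and $p_n=\sum_{i=1}^m q_i$, then $$0\le H(p_1,\dots,p_{n-1},q_1,\dots,q_m,p_{n+1},\dots,p_N)-H(p_1,\dots,p_N)\le p_n H\Big(\frac{q_1}{p_n},\dots,\frac{q_m}{p_n}\Big),$$ where the right-hand side is read as $0$ when $p_n=0$. (iv) Maximum: for every $N\ge1$ and $(p_1,\dots,p_N)\in\Omega_N$,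 $H(p_1,\dots,p_N)\le H(\frac1N,\dots,\frac1N)$. *)

theory Defs
  imports "HOL-Analysis.Analysis" "HOL-Combinatorics.Permutations"
begin

definition Omega :: "nat \<Rightarrow> real list set" where
  "Omega N = {ps. length ps = N \<and> (\<forall>p \<in> set ps. 0 \<le> p) \<and> sum_list ps = 1}"

(* A function on the union of all Omega N (N \<ge> 1) is a total function on real lists of which
   only the values on Omega N are constrained.  Lists carry no topology, so continuity on Omega N
   is stated for R^N with its product topology, read as functions on {..<N}.
   Indices are 0-based. *)
locale upper_entropy =
  fixes H :: "real list \<Rightarrow> real"
  assumes continuity:
    "\<And>N. 1 \<le> N \<Longrightarrow>
       continuous_map
         (subtopology (product_topology (\<lambda>_. euclideanreal) {..<N}) {x. map x [0..<N] \<in> Omega N})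
         euclideanreal (\<lambda>x. H (map x [0..<N]))"
  and zero_iff:
    "\<And>N ps. 1 \<le> N \<Longrightarrow> ps \<in> Omega N \<Longrightarrow> H ps = 0 \<longleftrightarrow> (\<exists>k<N. ps ! k = 1)"
  and symmetry:
    "\<And>N ps \<pi>. 1 \<le> N \<Longrightarrow> ps \<in> Omega N \<Longrightarrow> \<pi> permutes {..<N} \<Longrightarrow> H (permute_list \<pi> ps) = H ps"
  and increasing_lower:
    "\<And>N ps n qs. 1 \<le> N \<Longrightarrow> ps \<in> Omega N \<Longrightarrow> n < N \<Longrightarrow> 1 \<le> length qs \<Longrightarrow>
       (\<forall>q \<in> set qs. 0 \<le> q) \<Longrightarrow> ps ! n = sum_list qs \<Longrightarrow>
       0 \<le> H (take n ps @ qs @ drop (Suc n) ps) - H ps"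
  and increasing_upper:
    "\<And>N ps n qs. 1 \<le> N \<Longrightarrow> ps \<in> Omega N \<Longrightarrow> n < N \<Longrightarrow> 1 \<le> length qs \<Longrightarrow>
       (\<forall>q \<in> set qs. 0 \<le> q) \<Longrightarrow> ps ! n = sum_list qs \<Longrightarrow>
       H (take n ps @ qs @ drop (Suc n) ps) - H ps
         \<le> (if ps ! n = 0 then 0 else ps ! n * H (map (\<lambda>q. q / ps ! n) qs))"
  and maximum:
    "\<And>N ps. 1 \<le> N \<Longrightarrow> ps \<in> Omega N \<Longrightarrow> H ps \<le> H (replicate N (1 / real N))"

end

theory Submission
  imports Defs
begin

text \<open>
  Pass from the distribution of \<open>X\<close> to the joint distribution of \<open>(X, Y)\<close> by splitting the atoms
  \<open>p i\<close> one after the other, in increasing order of \<open>i\<close>. Replacing the atom \<open>p i\<close> by the row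
  \<open>p i * P i 0, \<dots>, p i * P i (m - 1)\<close> raises \<open>H\<close> by at most \<open>p i * H (P i 0, \<dots>, P i (m - 1))\<close>: this is
  the upper bound in the increasing property, as normalising the row by \<open>p i\<close> gives back the
  conditional distribution (\<open>split_atom\<close>). The bounds for the \<open>n\<close> splittings add up to the claim.
  The intermediate lists, in which the first \<open>k\<close> atoms are split, must be known to be probability
  vectors for the property to apply; this is preserved by each splitting (\<open>Omega_split_atom\<close>).
\<close>

lemma Omega_split_atom:
  assumes "as @ x # bs \<in> Omega N" and "rs \<in> Omega m"
  shows "as @ map ((*) x) rs @ bs \<in> Omega (length as + m + length bs)"
  using assms by (auto simp: Omega_def sum_list_const_mult)

text \<open>
  The bound also holds for an atom \<open>x = 0\<close>: both the increment allowed by the increasing property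
  and \<open>x * H rs\<close> are then zero.
\<close>

lemma (in upper_entropy) split_atom:
  assumes L: "as @ x # bs \<in> Omega N" and rs: "rs \<in> Omega m" and "1 \<le> m"
  shows "H (as @ map ((*) x) rs @ bs) \<le> H (as @ x # bs) + x * H rs"
proof -
  have N: "N = length as + Suc (length bs)" and "0 \<le> x"
    using L by (auto simp: Omega_def)
  have len: "length rs = m" and nonneg: "\<forall>r\<in>set rs. 0 \<le> r" and total: "sum_list rs = 1"
    using rs by (auto simp: Omega_def)
  have "H (take (length as) (as @ x # bs) @ map ((*) x) rs @ drop (Suc (length as)) (as @ x # bs))
          - H (as @ x # bs)
        \<le> (if (as @ x # bs) ! length as = 0 then 0
           else (as @ x # bs) ! length as
             * H (map (\<lambda>q. q / (as @ x # bs) ! length as) (map ((*) x) rs)))"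
    by (rule increasing_upper[OF _ L])
      (use N len nonneg total \<open>0 \<le> x\<close> \<open>1 \<le> m\<close> in \<open>auto simp: sum_list_const_mult\<close>)
  moreover have "map (\<lambda>q. q / x) (map ((*) x) rs) = rs" if "x \<noteq> 0"
    using that by (simp add: o_def)
  ultimately show ?thesis
    by (cases "x = 0") auto
qed

theorem mainTheorem3:
  fixes H :: "real list \<Rightarrow> real"
    and n m :: nat
    and p :: "nat \<Rightarrow> real"
    and P :: "nat \<Rightarrow> nat \<Rightarrow> real"
  assumes "upper_entropy H"
    and "1 \<le> n" and "1 \<le> m"
    and "map p [0..<n] \<in> Omega n"
    and "\<And>i. i < n \<Longrightarrow> map (P i) [0..<m] \<in> Omega m"
  shows "H (concat (map (\<lambda>i. map (\<lambda>j. p i * P i j) [0..<m]) [0..<n]))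
           \<le> H (map p [0..<n]) + (\<Sum>i<n. p i * H (map (P i) [0..<m]))"
proof -
  interpret upper_entropy H by fact
  define rows where "rows k = concat (map (\<lambda>i. map (\<lambda>j. p i * P i j) [0..<m]) [0..<k])" for k
  have "(\<exists>N. rows k @ map p [k..<n] \<in> Omega N) \<and>
      H (rows k @ map p [k..<n]) \<le> H (map p [0..<n]) + (\<Sum>i<k. p i * H (map (P i) [0..<m]))"
    if "k \<le> n" for k
    using that
  proof (induction k)
    case 0
    then show ?case using assms(4) by (auto simp: rows_def)
  next
    case (Suc k)
    have before: "rows k @ map p [k..<n] = rows k @ p k # map p [Suc k..<n]"
      using Suc.prems by (simp add: upt_conv_Cons)
    have after: "rows (Suc k) @ map p [Suc k..<n]
        = rows k @ map ((*) (p k)) (map (P k) [0..<m]) @ map p [Suc k..<n]"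
      by (simp add: rows_def o_def)
    obtain N where N: "rows k @ p k # map p [Suc k..<n] \<in> Omega N"
      using Suc before by auto
    have row: "map (P k) [0..<m] \<in> Omega m"
      using assms(5) Suc.prems by simp
    show ?case
      using Omega_split_atom[OF N row] split_atom[OF N row \<open>1 \<le> m\<close>] Suc.IH Suc.prems
      unfolding after before by auto
  qed
  from this[of n] show ?thesis by (simp add: rows_def)
qed

end
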